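(* For all $n\ge1$ and $\mathbf a\in\mathbb N^n$ with $a_1\neq0$, let $\alpha=\operatorname{revcomp}(\mathbf a)$, a composition of $n$. Then the primitive $f$-polynomial of $\mathrm{Flow}_n(\mathbf a)$ is $$\widetilde f^{(n)}(\mathbf a;x)=\frac1{x^n}\,P_\alpha\big(x,\ (x+1)^2-1,\ \dots,\ (x+1)^n-1\big),$$ where $$P_\alpha(x_1,\dots,x_n):=\sum_{\beta\ge_{\mathrm a}\alpha}(-1)^{n-\ell(\beta)}\,x_1^{\beta_1}\cdots x_{\ell(\beta)}^{\beta_{\ell(\beta)}},$$ the sum running over all compositions $\beta$ of $n$ refining $\alpha$.
   Context: $\mathbb N=\{0,1,2,\dots\}$, $[n]=\{1,\dots,n\}$. $K_{n+1}$ is the directed graph on $v_1,\dots,v_{n+1}$ with one edge $(v_i,v_j)$ for each $1\le i<j\le n+1$. For $\mathbf a\in\mathbb N^n$, an $\mathbf a$-flow is a function $f:E(K_{n+1})\to\mathbb R_{\ge0}$ with $\sum_{j>i}f(v_i,v_j)-\sum_{k<i}f(v_k,v_i)=a_i$ for all $i\in[n]$. $\mathrm{Flow}_n(\mathbf a)$ is the polytope of all $\mathbf a$-flows. A subgraph $H\subseteq K_{n+1}$ is $\mathbf a$-valid if its edge set is the support $\{e:f(e)>0\}$ of some $\mathbf a$-flow (its vertex set being the set of endpoints of these edges). $H$ is primitive if it is connected (as an undirected graph) and $V(H)=\{v_1,\dots,v_{n+1}\}$. The first Betti number is $\beta_1(H)=|E(H)|-|V(H)|+c(H)$, with $c(H)$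 the number of connected components. The primitive $f$-polynomial of $\mathrm{Flow}_n(\mathbf a)$ is $\widetilde f^{(n)}(\mathbf a;x)=\sum_H x^{\beta_1(H)}$, the sum over all $\mathbf a$-valid primitive subgraphs $H$ of $K_{n+1}$. A composition of $n$ is a tuple of positive integers with sum $n$; $\ell$ denotes its number of parts. $\alpha\le_{\mathrm a}\beta$ means that $\beta$ refines $\alpha$, i.e. $\beta$ is obtained by replacing, in order, each part $\alpha_j$ by a composition of $\alpha_j$. For $\mathbf a\in\mathbb N^n$ with $a_1\ne0$, $\operatorname{revcomp}(\mathbf a)$ is the composition of $n$ corresponding to the set $\{n-j: j\in[n-1],\ a_{j+1}\neq0\}$ under the bijection $\{s_1<\dots<s_k\}\mapsto(s_1,s_2-s_1,\dots,s_k-s_{k-1},n-s_k)$ from subsets of $[n-1]$ to compositions of $n$ (the empty set corresponding to $(n)$); e.g. $\operatorname{revcomp}(1,1,0,0,1,0,1,0)=(2,2,3,1)$. *)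

theory Defs
  imports
    "Graph_Theory.Digraph_Component"
    "HOL-Computational_Algebra.Computational_Algebra"
begin

text \<open>
  The graph \<open>K n\<close> is written $K_{n+1}$ on paper, and vertex \<open>i\<close> stands for $v_i$.
  A vector in $\mathbb N^n$ is a function \<open>a :: nat \<Rightarrow> nat\<close>; only the values
  \<open>a 1, \<dots>, a n\<close> are ever used.
\<close>

definition K :: "nat \<Rightarrow> nat pair_pre_digraph" where
  "K n = \<lparr>pverts = {1..n + 1}, parcs = {(i, j). 1 \<le> i \<and> i < j \<and> j \<le> n + 1}\<rparr>"

definition Flow :: "nat \<Rightarrow> (nat \<Rightarrow> nat) \<Rightarrow> (nat \<times> nat \<Rightarrow> real) set" where
  "Flow n a = {f \<in> parcs (K n) \<rightarrow>\<^sub>E {0..}.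
     \<forall>i\<in>{1..n}. (\<Sum>j\<in>{i<..n + 1}. f (i, j)) - (\<Sum>k\<in>{1..<i}. f (k, i)) = real (a i)}"

definition valid_subgraph :: "nat \<Rightarrow> (nat \<Rightarrow> nat) \<Rightarrow> nat pair_pre_digraph \<Rightarrow> bool" where
  "valid_subgraph n a H \<longleftrightarrow>
     subgraph (with_proj H) (with_proj (K n)) \<and>
     (\<exists>f\<in>Flow n a. parcs H = {e \<in> parcs (K n). f e > 0}) \<and>
     pverts H = Field (parcs H)"

definition primitive :: "nat \<Rightarrow> nat pair_pre_digraph \<Rightarrow> bool" where
  "primitive n H \<longleftrightarrow> connected (with_proj H) \<and> pverts H = {1..n + 1}"

text \<open>
  Connected components are those of the underlying undirected graph, that is, the strong
  components of the symmetrization.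
\<close>

definition num_components :: "nat pair_pre_digraph \<Rightarrow> nat" where
  "num_components H = card (pre_digraph.sccs (with_proj (mk_symmetric (with_proj H))))"

text \<open>
  A finite graph has at most as many vertices as edges and components together, so the subtraction
  on \<open>nat\<close> does not truncate.
\<close>

definition betti1 :: "nat pair_pre_digraph \<Rightarrow> nat" where
  "betti1 H = card (parcs H) + num_components H - card (pverts H)"

definition primitive_f_poly :: "nat \<Rightarrow> (nat \<Rightarrow> nat) \<Rightarrow> int poly" where
  "primitive_f_poly n a = (\<Sum>H | valid_subgraph n a H \<and> primitive n H. monom 1 (betti1 H))"

definition composition :: "nat \<Rightarrow> nat list \<Rightarrow> bool" where
  "composition n \<alpha> \<longleftrightarrow> (\<forall>p\<in>set \<alpha>. p > 0) \<and> sum_list \<alpha> = n"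

text \<open>\<open>refines \<beta> \<alpha>\<close> is $\alpha \le_{\mathrm a} \beta$.\<close>

definition refines :: "nat list \<Rightarrow> nat list \<Rightarrow> bool" where
  "refines \<beta> \<alpha> \<longleftrightarrow> (\<exists>\<gamma>s. list_all2 composition \<alpha> \<gamma>s \<and> \<beta> = concat \<gamma>s)"

text \<open>\<open>[s\<^sub>1, s\<^sub>2 - s\<^sub>1, \<dots>, s\<^sub>k - s\<^sub>k\<^sub>-\<^sub>1, n - s\<^sub>k]\<close> for \<open>S = {s\<^sub>1 < \<dots> < s\<^sub>k}\<close>\<close>

definition comp_of_set :: "nat \<Rightarrow> nat set \<Rightarrow> nat list" where
  "comp_of_set n S = (let s = sorted_list_of_set S in map2 (-) (s @ [n]) (0 # s))"

definition revcomp :: "nat \<Rightarrow> (nat \<Rightarrow> nat) \<Rightarrow> nat list" where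
  "revcomp n a = comp_of_set n {n - j | j. j \<in> {1..n - 1} \<and> a (j + 1) \<noteq> 0}"

text \<open>
  $P_\alpha(x_1, \dots, x_n)$ evaluated at elements \<open>x 1, \<dots>, x n\<close> of a commutative ring.
  List positions start at 0, so $\beta_i$ is \<open>\<beta> ! (i - 1)\<close>.
\<close>

definition P :: "nat \<Rightarrow> nat list \<Rightarrow> (nat \<Rightarrow> 'a::comm_ring_1) \<Rightarrow> 'a" where
  "P n \<alpha> x = (\<Sum>\<beta> | composition n \<beta> \<and> refines \<beta> \<alpha>.
     (-1) ^ (n - length \<beta>) * (\<Prod>i = 1..length \<beta>. x i ^ (\<beta> ! (i - 1))))"

end

theory Submission
  imports Defs
begin

text \<open>
  A set of edges is the support of a flow iff every vertex other than the sink that has an edge or a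
  supply has an outgoing one, and every vertex without supply that has an outgoing edge has an incoming
  one. Hence the valid primitive subgraphs are the sets \<open>E\<close> of edges in which every vertex of \<open>{1..n}\<close> has
  an outgoing edge and every \<open>i\<close> with \<open>a i = 0\<close> an incoming one; connectedness is then automatic, since
  outgoing edges lead to the sink, and the Betti number is \<open>card E - n\<close>.

  Inclusion-exclusion over the set \<open>T\<close> of vertices without supply that are forbidden as heads makes the choices
  of outgoing edges at different vertices independent, which gives the summand
  \<open>(-1) ^ card T * (\<Prod>i\<in>{1..n}. (1 + x) ^ card ({i<..n + 1} - T) - 1)\<close>. The sets \<open>T\<close> correspond to the
  compositions \<open>\<beta>\<close> refining \<open>\<alpha>\<close>: the vertices \<open>i \<ge> 2\<close> outside \<open>T\<close> become the partial sums \<open>n + 1 - i\<close> of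
  \<open>\<beta>\<close>, and \<open>card ({i<..n + 1} - T)\<close> is the index of the part of \<open>\<beta>\<close> that covers the position \<open>n + 1 - i\<close>.
\<close>

section \<open>Compositions and their partial sums\<close>

text \<open>These are the partial sums of a list over its nonempty prefixes. The total is kept, so a
  composition of \<open>n\<close> yields its usual subset of \<open>{1..<n}\<close> together with
  \<open>n\<close>.\<close>

primrec cuts :: "nat list \<Rightarrow> nat set" where
  "cuts [] = {}"
| "cuts (b # \<beta>) = insert b ((+) b ` cuts \<beta>)"

lemma finite_cuts [simp]: "finite (cuts \<beta>)"
  by (induction \<beta>) auto

lemma cuts_append: "cuts (\<gamma> @ \<beta>) = cuts \<gamma> \<union> (+) (sum_list \<gamma>) ` cuts \<beta>"
  by (induction \<gamma>) (auto simp: image_image image_Un add.assoc)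

lemma cuts_le: "s \<in> cuts \<beta> \<Longrightarrow> s \<le> sum_list \<beta>"
  by (induction \<beta> arbitrary: s) auto

lemma cuts_pos: "\<forall>p\<in>set \<beta>. 0 < p \<Longrightarrow> s \<in> cuts \<beta> \<Longrightarrow> 0 < s"
  by (induction \<beta> arbitrary: s) auto

lemma sum_list_in_cuts: "\<beta> \<noteq> [] \<Longrightarrow> sum_list \<beta> \<in> cuts \<beta>"
proof (induction \<beta>)
  case (Cons b \<beta>)
  then show ?case by (cases "\<beta> = []") auto
qed simp

text \<open>Makes the \<open>insert\<close> in \<open>cuts\<close> a disjoint one, so that partial
  sums can be counted and the first one cancelled.\<close>

lemma head_notin_cuts:
  "\<forall>p\<in>set \<beta>. 0 < p \<Longrightarrow> b \<notin> (+) b ` cuts \<beta>"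
  using cuts_pos by fastforce

lemma card_cuts: "\<forall>p\<in>set \<beta>. 0 < p \<Longrightarrow> card (cuts \<beta>) = length \<beta>"
  by (induction \<beta>) (auto simp: head_notin_cuts card_image)

text \<open>The first part is the least partial sum, so it can be read off from the set; removing it
  and shifting back leaves the partial sums of the tail.\<close>

lemma cuts_inj:
  assumes "cuts \<beta> = cuts \<gamma>" "\<forall>p\<in>set \<beta>. 0 < p" "\<forall>p\<in>set \<gamma>. 0 < p"
  shows "\<beta> = \<gamma>"
  using assms
proof (induction \<beta> arbitrary: \<gamma>)
  case Nil
  then show ?case by (cases \<gamma>) auto
next
  case (Cons b \<beta>)
  then obtain c \<delta> where \<gamma>: "\<gamma> = c # \<delta>" by (cases \<gamma>) auto
  have "b = c"
  proof (rule antisym)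
    have "c \<in> cuts (b # \<beta>)" using Cons.prems(1) \<gamma> by simp
    then show "b \<le> c" by auto
    have "b \<in> cuts (c # \<delta>)" using Cons.prems(1) \<gamma> by auto
    then show "c \<le> b" by auto
  qed
  moreover have "(+) b ` cuts \<beta> = (+) c ` cuts \<delta>"
    using Cons.prems head_notin_cuts[of \<beta> b] head_notin_cuts[of \<delta> c] \<open>b = c\<close> \<gamma>
    by (simp add: insert_ident)
  ultimately have "cuts \<beta> = cuts \<delta>"
    by (simp add: inj_image_eq_iff)
  with Cons \<gamma> \<open>b = c\<close> show ?case by auto
qed

lemma cuts_split:
  assumes "a \<in> cuts \<beta>"
  obtains \<gamma> \<delta> where "\<beta> = \<gamma> @ \<delta>" "sum_list \<gamma> = a"
  using assms
proof (induction \<beta> arbitrary: a thesis)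
  case (Cons b \<beta>)
  from Cons.prems(2) consider "a = b" | s where "s \<in> cuts \<beta>" "a = b + s" by auto
  then show ?case
  proof cases
    case 1
    then show ?thesis by (intro Cons.prems(1)[of "[b]" \<beta>]) auto
  next
    case 2
    from Cons.IH[OF _ 2(1)] obtain \<gamma> \<delta> where "\<beta> = \<gamma> @ \<delta>" "sum_list \<gamma> = s" by blast
    with 2 show ?thesis by (intro Cons.prems(1)[of "b # \<gamma>" \<delta>]) auto
  qed
qed simp

section \<open>Refinement as inclusion of partial sums\<close>

lemma refines_Cons:
  "refines \<beta> (a # \<alpha>) \<longleftrightarrow> (\<exists>\<gamma> \<delta>. \<beta> = \<gamma> @ \<delta> \<and> composition a \<gamma> \<and> refines \<delta> \<alpha>)"
  by (fastforce simp: refines_def list_all2_Cons1)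

text \<open>A refinement must have a partial sum where the first part \<open>a\<close> ends.
  Splitting \<beta> there gives a composition of \<open>a\<close> and a remainder that has to refine
  the remaining parts.\<close>

lemma refines_iff_cuts:
  assumes "\<forall>p\<in>set \<alpha>. 0 < p" "composition (sum_list \<alpha>) \<beta>"
  shows "refines \<beta> \<alpha> \<longleftrightarrow> cuts \<alpha> \<subseteq> cuts \<beta>"
  using assms
proof (induction \<alpha> arbitrary: \<beta>)
  case Nil
  then show ?case by (cases \<beta>) (auto simp: refines_def composition_def)
next
  case (Cons a \<alpha>)
  show ?case
  proof
    assume "refines \<beta> (a # \<alpha>)"
    then obtain \<gamma> \<delta> where *: "\<beta> = \<gamma> @ \<delta>" "composition a \<gamma>" "refines \<delta> \<alpha>"
      by (auto simp: refines_Cons)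
    then have "\<gamma> \<noteq> []" "sum_list \<gamma> = a"
      using Cons.prems(1) by (auto simp: composition_def)
    then have "a \<in> cuts \<gamma>"
      using sum_list_in_cuts by blast
    moreover have "cuts \<alpha> \<subseteq> cuts \<delta>"
      using Cons.IH[of \<delta>] Cons.prems * by (auto simp: composition_def)
    ultimately show "cuts (a # \<alpha>) \<subseteq> cuts \<beta>"
      using * by (auto simp: cuts_append composition_def)
  next
    assume sub: "cuts (a # \<alpha>) \<subseteq> cuts \<beta>"
    then have "a \<in> cuts \<beta>" by auto
    then obtain \<gamma> \<delta> where *: "\<beta> = \<gamma> @ \<delta>" "sum_list \<gamma> = a"
      by (rule cuts_split)
    have "cuts \<alpha> \<subseteq> cuts \<delta>"
    proof
      fix s assume "s \<in> cuts \<alpha>"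
      \<comment> \<open>Positivity of \<open>s\<close> puts \<open>a + s\<close> beyond every
        partial sum of \<gamma>, so it has to come from \<delta>.\<close>
      then have "a + s \<in> cuts \<gamma> \<union> (+) a ` cuts \<delta>" "0 < s"
        using sub cuts_pos[of \<alpha> s] Cons.prems(1) * by (auto simp: cuts_append)
      then show "s \<in> cuts \<delta>"
        using cuts_le[of "a + s" \<gamma>] * by auto
    qed
    moreover have "composition (sum_list \<alpha>) \<delta>" "composition a \<gamma>"
      using Cons.prems * by (auto simp: composition_def)
    ultimately show "refines \<beta> (a # \<alpha>)"
      using Cons.IH[of \<delta>] Cons.prems * by (auto simp: refines_Cons)
  qed
qed

text \<open>The unit cell \<open>{p<..<p + 1}\<close> lies in the block of \<open>\<beta>\<close> whose index is one more than the number of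
  cuts at or below \<open>p\<close>.\<close>

lemma prod_blocks:
  fixes y :: "nat \<Rightarrow> 'a::comm_monoid_mult"
  assumes "\<forall>p\<in>set \<beta>. 0 < p"
  shows "(\<Prod>i<length \<beta>. y i ^ (\<beta> ! i)) = (\<Prod>p<sum_list \<beta>. y (card {s \<in> cuts \<beta>. s \<le> p}))"
  using assms
proof (induction \<beta> arbitrary: y)
  case (Cons b \<beta>)
  let ?c = "\<lambda>p. card {s \<in> cuts (b # \<beta>). s \<le> p}"
  have lo: "?c p = 0" if "p < b" for p
    using that by (auto simp: card_eq_0_iff)
  \<comment> \<open>Beyond the first block the cut \<open>b\<close> counts once more, so the
    induction hypothesis is needed for the shifted sequence
    \<open>\<lambda>i. y (Suc i)\<close>.\<close>
  have hi: "?c (b + p) = Suc (card {s \<in> cuts \<beta>. s \<le> p})" for p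
  proof -
    have "{s \<in> cuts (b # \<beta>). s \<le> b + p} = insert b ((+) b ` {s \<in> cuts \<beta>. s \<le> p})"
      by auto
    moreover have "b \<notin> (+) b ` {s \<in> cuts \<beta>. s \<le> p}"
      using head_notin_cuts[of \<beta> b] Cons.prems by auto
    ultimately show ?thesis
      by (simp add: card_image)
  qed
  have "(\<Prod>i<length (b # \<beta>). y i ^ ((b # \<beta>) ! i)) = y 0 ^ b * (\<Prod>i<length \<beta>. y (Suc i) ^ (\<beta> ! i))"
    by (simp add: prod.lessThan_Suc_shift del: prod.lessThan_Suc)
  also have "(\<Prod>i<length \<beta>. y (Suc i) ^ (\<beta> ! i)) = (\<Prod>p<sum_list \<beta>. y (Suc (card {s \<in> cuts \<beta>. s \<le> p})))"
    using Cons.IH[of "\<lambda>i. y (Suc i)"] Cons.prems by simp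
  also have "\<dots> = (\<Prod>p<sum_list \<beta>. y (?c (b + p)))"
    by (simp only: hi)
  also have "\<dots> = (\<Prod>p\<in>{b..<b + sum_list \<beta>}. y (?c p))"
    using prod.shift_bounds_nat_ivl[of "\<lambda>p. y (?c p)" 0 b "sum_list \<beta>"]
    by (simp add: atLeast0LessThan add.commute)
  also have "y 0 ^ b = (\<Prod>p\<in>{0..<b}. y (?c p))"
    by (simp add: lo del: cuts.simps)
  also have "(\<Prod>p\<in>{0..<b}. y (?c p)) * (\<Prod>p\<in>{b..<b + sum_list \<beta>}. y (?c p)) = (\<Prod>p\<in>{0..<b + sum_list \<beta>}. y (?c p))"
    by (rule prod.atLeastLessThan_concat) auto
  finally show ?case by (simp add: atLeast0LessThan)
qed simp

section \<open>Compositions from subsets\<close>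

text \<open>Taking differences and taking partial sums are inverse to each other. In
  \<open>comp_of_set\<close> the start \<open>b\<close> is 0; a general \<open>b\<close> lets the
  induction drop the first entry.\<close>

lemma cuts_differences:
  assumes "sorted_wrt (<) (b # xs)"
  shows "(+) b ` cuts (map2 (-) xs (b # butlast xs)) = set xs \<and>
    (\<forall>p\<in>set (map2 (-) xs (b # butlast xs)). 0 < p) \<and>
    sum_list (map2 (-) xs (b # butlast xs)) = last (b # xs) - b"
  using assms
proof (induction xs arbitrary: b)
  case (Cons x xs)
  have eq: "map2 (-) (x # xs) (b # butlast (x # xs)) = (x - b) # map2 (-) xs (x # butlast xs)"
    by (cases xs) auto
  have "sorted_wrt (<) (x # xs)" using Cons.prems by simp
  from Cons.IH[OF this]
  have "(+) x ` cuts (map2 (-) xs (x # butlast xs)) = set xs"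
    "\<forall>p\<in>set (map2 (-) xs (x # butlast xs)). 0 < p"
    "sum_list (map2 (-) xs (x # butlast xs)) = last (x # xs) - x"
    by blast+
  moreover have "b < x" "x \<le> last (x # xs)"
    using Cons.prems by (auto simp: less_imp_le)
  \<comment> \<open>Strict increase makes the truncated difference \<open>x - b\<close> exact, so
    shifting by \<open>x - b\<close> and then by \<open>b\<close> is shifting by
    \<open>x\<close>.\<close>
  moreover from this have "b + (x - b + s) = x + s" for s by simp
  ultimately show ?case
    unfolding eq by (simp add: image_image image_Un del: map_map)
qed simp

lemma
  assumes "S \<subseteq> {1..<n}" "1 \<le> n"
  shows composition_comp_of_set: "composition n (comp_of_set n S)"
    and cuts_comp_of_set: "cuts (comp_of_set n S) = insert n S"
proof -
  have fin: "finite S" using assms(1) by (rule finite_subset) simp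
  let ?s = "sorted_list_of_set S"
  have "sorted_wrt (<) (0 # ?s @ [n])"
    using assms fin by (auto simp: sorted_wrt_append)
  from cuts_differences[OF this]
  show "composition n (comp_of_set n S)" "cuts (comp_of_set n S) = insert n S"
    using fin by (auto simp: comp_of_set_def composition_def Let_def)
qed

text \<open>The inverse takes partial sums and drops the total \<open>n\<close>;
  \<open>cuts_inj\<close> shows that this loses nothing.\<close>

lemma bij_betw_comp_of_set:
  assumes "1 \<le> n"
  shows "bij_betw (comp_of_set n) (Pow {1..<n}) {\<beta>. composition n \<beta>}"
proof (rule bij_betw_byWitness[where f' = "\<lambda>\<beta>. cuts \<beta> - {n}"])
  show "\<forall>S\<in>Pow {1..<n}. cuts (comp_of_set n S) - {n} = S"
    using cuts_comp_of_set assms by force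
  have *: "cuts \<beta> - {n} \<subseteq> {1..<n} \<and> insert n (cuts \<beta> - {n}) = cuts \<beta>" if "composition n \<beta>" for \<beta>
  proof -
    have \<beta>: "\<forall>p\<in>set \<beta>. 0 < p" "sum_list \<beta> = n" "\<beta> \<noteq> []"
      using that assms by (auto simp: composition_def)
    have "n \<in> cuts \<beta>"
      using sum_list_in_cuts \<beta> by blast
    moreover have "0 < s" "s \<le> n" if "s \<in> cuts \<beta>" for s
      using cuts_pos cuts_le \<beta> that by blast+
    ultimately show ?thesis by force
  qed
  show "\<forall>\<beta>\<in>{\<beta>. composition n \<beta>}. comp_of_set n (cuts \<beta> - {n}) = \<beta>"
  proof (intro ballI, elim CollectE)
    fix \<beta> assume \<beta>: "composition n \<beta>"
    let ?S = "cuts \<beta> - {n}"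
    have "?S \<subseteq> {1..<n}" using *[OF \<beta>] by blast
    from cuts_comp_of_set[OF this assms] composition_comp_of_set[OF this assms]
    show "comp_of_set n ?S = \<beta>"
      using \<beta> *[OF \<beta>] by (intro cuts_inj) (auto simp: composition_def)
  qed
  show "comp_of_set n ` Pow {1..<n} \<subseteq> {\<beta>. composition n \<beta>}"
    using composition_comp_of_set assms by auto
  show "(\<lambda>\<beta>. cuts \<beta> - {n}) ` {\<beta>. composition n \<beta>} \<subseteq> Pow {1..<n}"
    using * by auto
qed

text \<open>Under the bijection with subsets, refinement becomes inclusion, the length becomes
  \<open>card S + 1\<close>, and the product over parts becomes one over the unit cells
  \<open>p < n\<close>.\<close>

lemma P_comp_of_set:
  fixes x :: "nat \<Rightarrow> 'a::comm_ring_1"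
  assumes "1 \<le> n" "R \<subseteq> {1..<n}"
  shows "P n (comp_of_set n R) x =
    (\<Sum>S | R \<subseteq> S \<and> S \<subseteq> {1..<n}. (-1) ^ (n - 1 - card S) * (\<Prod>p<n. x (Suc (card {s \<in> S. s \<le> p}))))"
proof -
  let ?\<alpha> = "comp_of_set n R"
  have ref: "refines (comp_of_set n S) ?\<alpha> \<longleftrightarrow> R \<subseteq> S" if "S \<subseteq> {1..<n}" for S
  proof -
    have "refines (comp_of_set n S) ?\<alpha> \<longleftrightarrow> cuts ?\<alpha> \<subseteq> cuts (comp_of_set n S)"
      using composition_comp_of_set[OF that assms(1)] composition_comp_of_set[OF assms(2,1)]
      by (intro refines_iff_cuts) (auto simp: composition_def)
    then show ?thesis
      using assms that by (auto simp: cuts_comp_of_set)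
  qed
  have "bij_betw (comp_of_set n) {S. R \<subseteq> S \<and> S \<subseteq> {1..<n}} {\<beta>. composition n \<beta> \<and> refines \<beta> ?\<alpha>}"
  proof (rule bij_betw_subset[OF bij_betw_comp_of_set[OF assms(1)]])
    show "comp_of_set n ` {S. R \<subseteq> S \<and> S \<subseteq> {1..<n}} = {\<beta>. composition n \<beta> \<and> refines \<beta> ?\<alpha>}"
    proof (intro equalityI subsetI)
      fix \<beta> assume *: "\<beta> \<in> {\<beta>. composition n \<beta> \<and> refines \<beta> ?\<alpha>}"
      then obtain S where "S \<subseteq> {1..<n}" "\<beta> = comp_of_set n S"
        using bij_betw_imp_surj_on[OF bij_betw_comp_of_set[OF assms(1)]] by auto
      with * ref show "\<beta> \<in> comp_of_set n ` {S. R \<subseteq> S \<and> S \<subseteq> {1..<n}}"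
        by auto
    qed (use ref composition_comp_of_set assms in auto)
  qed auto
  from sum.reindex_bij_betw[OF this, symmetric]
  have "P n ?\<alpha> x = (\<Sum>S | R \<subseteq> S \<and> S \<subseteq> {1..<n}. (-1) ^ (n - length (comp_of_set n S)) *
      (\<Prod>i = 1..length (comp_of_set n S). x i ^ (comp_of_set n S ! (i - 1))))"
    unfolding P_def .
  also have "\<dots> = (\<Sum>S | R \<subseteq> S \<and> S \<subseteq> {1..<n}. (-1) ^ (n - 1 - card S) * (\<Prod>p<n. x (Suc (card {s \<in> S. s \<le> p}))))"
  proof (rule sum.cong[OF refl], elim CollectE conjE)
    fix S assume S: "S \<subseteq> {1..<n}"
    let ?\<beta> = "comp_of_set n S"
    have comp: "\<forall>p\<in>set ?\<beta>. 0 < p" "sum_list ?\<beta> = n"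
      using composition_comp_of_set[OF S assms(1)] by (auto simp: composition_def)
    have cuts: "cuts ?\<beta> = insert n S" by (rule cuts_comp_of_set[OF S assms(1)])
    have fin: "finite S" using S by (rule finite_subset) simp
    have "n \<notin> S" using S by auto
    have len: "length ?\<beta> = Suc (card S)"
      using card_cuts[OF comp(1)] fin \<open>n \<notin> S\<close> by (simp add: cuts)
    have "(\<Prod>i = 1..length ?\<beta>. x i ^ (?\<beta> ! (i - 1))) = (\<Prod>i<length ?\<beta>. x (Suc i) ^ (?\<beta> ! i))"
      by (rule prod.reindex_bij_witness[of _ Suc "\<lambda>i. i - 1"]) auto
    also have "\<dots> = (\<Prod>p<n. x (Suc (card {s \<in> insert n S. s \<le> p})))"
      using prod_blocks[OF comp(1), of "\<lambda>i. x (Suc i)"] comp(2) cuts by simp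
    \<comment> \<open>The final cut \<open>n\<close> is never at or below a cell
      \<open>p < n\<close>.\<close>
    also have "\<dots> = (\<Prod>p<n. x (Suc (card {s \<in> S. s \<le> p})))"
      by (intro prod.cong refl arg_cong[where f = "\<lambda>X. x (Suc (card X))"]) auto
    finally show "(-1) ^ (n - length ?\<beta>) * (\<Prod>i = 1..length ?\<beta>. x i ^ (?\<beta> ! (i - 1))) =
      (-1) ^ (n - 1 - card S) * (\<Prod>p<n. x (Suc (card {s \<in> S. s \<le> p})))"
      using len by simp
  qed
  finally show ?thesis .
qed

section \<open>Inclusion-exclusion\<close>

text \<open>The binomial theorem by subsets. It serves at \<open>-1\<close> for inclusion-exclusion
  and at \<open>x\<close> for the choice of out-neighbours of one vertex.\<close>

lemma sum_Pow_power_card: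
  fixes x :: "'a::comm_ring_1"
  assumes "finite B"
  shows "(\<Sum>X\<in>Pow B. x ^ card X) = (1 + x) ^ card B"
proof -
  have "(1 + x) ^ card B = (\<Prod>b\<in>B. x + 1)" by (simp add: add.commute)
  also have "\<dots> = (\<Sum>X\<in>Pow B. x ^ card X)" by (subst prod_add[OF assms]) simp
  finally show ?thesis ..
qed

text \<open>After swapping the sums, a fixed \<open>E\<close> contributes an alternating sum over
  the subsets of \<open>Z - R E\<close>, which vanishes unless that set is empty. In the application
  \<open>R E\<close> is the set of heads of \<open>E\<close>.\<close>

lemma inclusion_exclusion_sum:
  fixes w :: "'b \<Rightarrow> 'a::comm_ring_1" and R :: "'b \<Rightarrow> 'c set"
  assumes "finite F" "finite Z"
  shows "(\<Sum>E | E \<in> F \<and> Z \<subseteq> R E. w E) =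
    (\<Sum>T\<in>Pow Z. (-1) ^ card T * (\<Sum>E | E \<in> F \<and> T \<inter> R E = {}. w E))"
proof -
  have "(\<Sum>T\<in>Pow Z. (-1) ^ card T * (\<Sum>E | E \<in> F \<and> T \<inter> R E = {}. w E)) =
      (\<Sum>T\<in>Pow Z. \<Sum>E\<in>F. if T \<inter> R E = {} then (-1) ^ card T * w E else 0)"
    using assms by (auto simp: sum_distrib_left sum.inter_filter intro!: sum.cong)
  also have "\<dots> = (\<Sum>E\<in>F. \<Sum>T\<in>Pow Z. if T \<inter> R E = {} then (-1) ^ card T * w E else 0)"
    by (rule sum.swap)
  also have "\<dots> = (\<Sum>E\<in>F. if Z \<subseteq> R E then w E else 0)"
  proof (rule sum.cong[OF refl])
    fix E
    have "(\<Sum>T\<in>Pow Z. if T \<inter> R E = {} then (-1) ^ card T * w E else 0) =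
        (\<Sum>T | T \<in> Pow Z \<and> T \<inter> R E = {}. (-1) ^ card T * w E)"
      using assms by (intro sum.inter_filter[symmetric]) simp
    also have "{T. T \<in> Pow Z \<and> T \<inter> R E = {}} = Pow (Z - R E)" by auto
    also have "(\<Sum>T\<in>Pow (Z - R E). (-1) ^ card T * w E) = 0 ^ card (Z - R E) * w E"
      using sum_Pow_power_card[of "Z - R E" "-1 :: 'a"] assms
      by (simp flip: sum_distrib_right)
    also have "\<dots> = (if Z \<subseteq> R E then w E else 0)"
      using assms by (auto simp: power_0_left)
    finally show "(\<Sum>T\<in>Pow Z. if T \<inter> R E = {} then (-1) ^ card T * w E else 0) =
      (if Z \<subseteq> R E then w E else 0)" .
  qed
  also have "\<dots> = (\<Sum>E | E \<in> F \<and> Z \<subseteq> R E. w E)"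
    using assms by (simp add: sum.inter_filter)
  finally show ?thesis ..
qed

text \<open>A relation is an independent choice of a nonempty set of successors for each
  \<open>i\<close>; the \<open>- 1\<close> in each factor removes the empty choice.\<close>

lemma sum_relations_power_card:
  fixes x :: "'a::comm_ring_1"
  assumes "finite I" "\<And>i. i \<in> I \<Longrightarrow> finite (B i)"
  shows "(\<Sum>E | E \<subseteq> Sigma I B \<and> I \<subseteq> Domain E. x ^ card E) = (\<Prod>i\<in>I. (1 + x) ^ card (B i) - 1)"
proof -
  have "(\<Prod>i\<in>I. (1 + x) ^ card (B i) - 1) = (\<Prod>i\<in>I. \<Sum>X\<in>Pow (B i) - {{}}. x ^ card X)"
    using assms(2) by (intro prod.cong refl) (simp add: sum_diff1 sum_Pow_power_card)
  also have "\<dots> = (\<Sum>g\<in>Pi\<^sub>E I (\<lambda>i. Pow (B i) - {{}}). \<Prod>i\<in>I. x ^ card (g i))"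
    using assms by (intro prod_sum_PiE) auto
  also have "\<dots> = (\<Sum>E | E \<subseteq> Sigma I B \<and> I \<subseteq> Domain E. x ^ card E)"
  proof (rule sum.reindex_bij_witness[of _ "\<lambda>E. \<lambda>i\<in>I. E `` {i}" "Sigma I"])
    fix g assume g: "g \<in> Pi\<^sub>E I (\<lambda>i. Pow (B i) - {{}})"
    then show "(\<lambda>i\<in>I. Sigma I g `` {i}) = g" 
      by (intro ext) (auto simp: PiE_iff extensional_def restrict_def)
    show "Sigma I g \<in> {E. E \<subseteq> Sigma I B \<and> I \<subseteq> Domain E}"
      using g by (fastforce simp: PiE_iff)
    have "\<forall>i\<in>I. finite (g i)"
      using g assms(2) by (auto simp: PiE_iff intro: finite_subset)
    then show "x ^ card (Sigma I g) = (\<Prod>i\<in>I. x ^ card (g i))"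
      using assms(1) by (simp add: power_sum)
  next
    fix E assume E: "E \<in> {E. E \<subseteq> Sigma I B \<and> I \<subseteq> Domain E}"
    then show "Sigma I (\<lambda>i\<in>I. E `` {i}) = E"
      by (auto split: if_splits)
    show "(\<lambda>i\<in>I. E `` {i}) \<in> Pi\<^sub>E I (\<lambda>i. Pow (B i) - {{}})"
      using E by (auto simp: PiE_iff)
  qed
  finally show ?thesis ..
qed

section \<open>Supports of flows\<close>

text \<open>The amount passing through vertex \<open>i\<close> when every vertex splits its supply
  and inflow equally among its outgoing edges. The guard \<open>k < i\<close> makes the recursion
  terminate for every \<open>E\<close>.\<close>

function node_flow :: "(nat \<times> nat) set \<Rightarrow> (nat \<Rightarrow> nat) \<Rightarrow> nat \<Rightarrow> real" where
  "node_flow E a i = real (a i) +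
     (\<Sum>k | k < i \<and> (k, i) \<in> E. node_flow E a k / real (card (E `` {k})))"
  by auto
termination by (relation "measure (\<lambda>(E, a, i). i)") auto

declare node_flow.simps [simp del]

lemma node_flow_nonneg: "0 \<le> node_flow E a i"
proof (induction i rule: less_induct)
  case (less i)
  then show ?case
    by (subst node_flow.simps) (intro add_nonneg_nonneg sum_nonneg divide_nonneg_nonneg; simp)
qed

lemma parcs_K: "parcs (K n) = (SIGMA i:{1..n}. {i<..n + 1})"
  by (auto simp: K_def)

context
  fixes n :: nat and a :: "nat \<Rightarrow> nat" and E :: "(nat \<times> nat) set"
  assumes E: "E \<subseteq> parcs (K n)"
begin

lemma finite_arcs_at: "finite (E `` {i})"
proof (rule finite_subset)
  show "E `` {i} \<subseteq> {..n + 1}" using E by (auto simp: parcs_K)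
qed simp

text \<open>Induction along the vertex order: a vertex has its own supply or receives a positive
  share from a smaller vertex.\<close>

lemma node_flow_pos:
  assumes out: "{1..n} \<subseteq> Domain E"
    and inn: "{i \<in> {1..n}. a i = 0} \<subseteq> Range E"
    and i: "i \<in> {1..n}"
  shows "0 < node_flow E a i"
  using i
proof (induction i rule: less_induct)
  case (less i)
  let ?g = "\<lambda>k. node_flow E a k / real (card (E `` {k}))"
  have nonneg: "0 \<le> (\<Sum>k | k < i \<and> (k, i) \<in> E. ?g k)"
    by (intro sum_nonneg divide_nonneg_nonneg) (auto simp: node_flow_nonneg)
  show ?case
  proof (cases "a i = 0")
    case False
    then show ?thesis using nonneg by (subst node_flow.simps) simp
  next
    case True
    then obtain k where k: "(k, i) \<in> E" using inn less.prems by auto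
    then have "k < i" "k \<in> {1..n}" using E by (auto simp: parcs_K)
    then have "0 < node_flow E a k" using less.IH by blast
    moreover have "card (E `` {k}) > 0" using k finite_arcs_at by (auto simp: card_gt_0_iff)
    ultimately have "0 < ?g k" by simp
    then have "0 < (\<Sum>k | k < i \<and> (k, i) \<in> E. ?g k)"
      using k \<open>k < i\<close> by (intro sum_pos2[of _ k]) (auto simp: node_flow_nonneg)
    then show ?thesis by (subst node_flow.simps) simp
  qed
qed

text \<open>The witness is the equal-splitting flow. The outflow at \<open>i\<close> adds up to
  \<open>node_flow E a i\<close>, whose recursion equation is exactly flow conservation.\<close>

lemma exists_flow_with_support:
  assumes out: "{1..n} \<subseteq> Domain E"
    and inn: "{i \<in> {1..n}. a i = 0} \<subseteq> Range E"
  shows "\<exists>f\<in>Flow n a. E = {e \<in> parcs (K n). f e > 0}"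
proof
  let ?g = "\<lambda>k. node_flow E a k / real (card (E `` {k}))"
  \<comment> \<open>Restricting to the edges of \<open>K n\<close> makes the function extensional,
    as \<open>Flow\<close> demands.\<close>
  let ?f = "\<lambda>e\<in>parcs (K n). if e \<in> E then ?g (fst e) else 0"
  have cpos: "card (E `` {k}) > 0" if "k \<in> {1..n}" for k
    using that out finite_arcs_at[of k] by (auto simp: card_gt_0_iff)
  have "(\<Sum>j\<in>{i<..n + 1}. ?f (i, j)) - (\<Sum>k\<in>{1..<i}. ?f (k, i)) = real (a i)" if i: "i \<in> {1..n}" for i
  proof -
    have "(\<Sum>j\<in>{i<..n + 1}. ?f (i, j)) = (\<Sum>j\<in>{i<..n + 1}. if (i, j) \<in> E then ?g i else 0)"
      using i by (intro sum.cong refl) (auto simp: parcs_K)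
    also have "\<dots> = (\<Sum>j | j \<in> {i<..n + 1} \<and> (i, j) \<in> E. ?g i)"
      by (rule sum.inter_filter[symmetric]) simp
    also have "{j. j \<in> {i<..n + 1} \<and> (i, j) \<in> E} = E `` {i}"
      using E by (auto simp: parcs_K)
    also have "(\<Sum>j\<in>E `` {i}. ?g i) = node_flow E a i"
      using cpos[OF i] by simp
    finally have 1: "(\<Sum>j\<in>{i<..n + 1}. ?f (i, j)) = node_flow E a i" .
    have "(\<Sum>k\<in>{1..<i}. ?f (k, i)) = (\<Sum>k\<in>{1..<i}. if (k, i) \<in> E then ?g k else 0)"
      using i by (intro sum.cong refl) (auto simp: parcs_K)
    also have "\<dots> = (\<Sum>k | k \<in> {1..<i} \<and> (k, i) \<in> E. ?g k)"
      by (rule sum.inter_filter[symmetric]) simp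
    also have "{k. k \<in> {1..<i} \<and> (k, i) \<in> E} = {k. k < i \<and> (k, i) \<in> E}"
      using E by (auto simp: parcs_K)
    finally show ?thesis
      unfolding 1 by (subst node_flow.simps) simp
  qed
  moreover have "?f \<in> parcs (K n) \<rightarrow>\<^sub>E {0..}"
    by (simp add: node_flow_nonneg)
  ultimately show "?f \<in> Flow n a"
    unfolding Flow_def by blast
  have "0 < ?g (fst e)" if "e \<in> E" for e
  proof -
    have "fst e \<in> {1..n}" using that E by (auto simp: parcs_K)
    then show ?thesis using node_flow_pos[OF out inn] cpos by simp
  qed
  then show "E = {e \<in> parcs (K n). ?f e > 0}"
    using E by auto
qed

end

text \<open>By nonnegativity, a vertex has an outgoing or incoming support edge iff its total
  outflow or inflow is positive; conservation then compares the two totals.\<close>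

lemma flow_support_degrees:
  assumes f: "f \<in> Flow n a" and E: "E = {e \<in> parcs (K n). f e > 0}" and i: "i \<in> {1..n}"
  shows "i \<in> Field E \<Longrightarrow> i \<in> Domain E"
    and "i \<in> Domain E \<Longrightarrow> a i = 0 \<Longrightarrow> i \<in> Range E"
proof -
  have nonneg: "0 \<le> f e" if "e \<in> parcs (K n)" for e
    using f that by (auto simp: Flow_def)
  have cons: "(\<Sum>j\<in>{i<..n + 1}. f (i, j)) - (\<Sum>k\<in>{1..<i}. f (k, i)) = real (a i)"
    using f i by (auto simp: Flow_def)
  have out: "i \<in> Domain E \<longleftrightarrow> 0 < (\<Sum>j\<in>{i<..n + 1}. f (i, j))"
  proof
    assume "i \<in> Domain E"
    then obtain j where "(i, j) \<in> parcs (K n)" "f (i, j) > 0" using E by auto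
    then show "0 < (\<Sum>j\<in>{i<..n + 1}. f (i, j))"
      using nonneg i by (intro sum_pos2[of _ j]) (auto simp: parcs_K)
  next
    assume "0 < (\<Sum>j\<in>{i<..n + 1}. f (i, j))"
    then obtain j where "j \<in> {i<..n + 1}" "0 < f (i, j)"
      by (meson not_less sum_nonpos)
    then show "i \<in> Domain E" using E i by (auto simp: parcs_K)
  qed
  have inn: "i \<in> Range E \<longleftrightarrow> 0 < (\<Sum>k\<in>{1..<i}. f (k, i))"
  proof
    assume "i \<in> Range E"
    then obtain k where "(k, i) \<in> parcs (K n)" "f (k, i) > 0" using E by auto
    then show "0 < (\<Sum>k\<in>{1..<i}. f (k, i))"
      using nonneg i by (intro sum_pos2[of _ k]) (auto simp: parcs_K)
  next
    assume "0 < (\<Sum>k\<in>{1..<i}. f (k, i))"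
    then obtain k where "k \<in> {1..<i}" "0 < f (k, i)"
      by (meson not_less sum_nonpos)
    then have "(k, i) \<in> E" using E i by (auto simp: parcs_K)
    then show "i \<in> Range E" by blast
  qed
  show "i \<in> Field E \<Longrightarrow> i \<in> Domain E"
    using out inn cons by (auto simp: Field_def)
  show "i \<in> Domain E \<Longrightarrow> a i = 0 \<Longrightarrow> i \<in> Range E"
    using out inn cons by auto
qed

section \<open>Connectedness and the Betti number\<close>

text \<open>In the symmetrization all vertices reach each other, so the whole vertex set is the only
  maximal class of mutually reachable vertices.\<close>

lemma num_components_connected:
  assumes "wf_digraph (with_proj H)" "connected (with_proj H)"
  shows "num_components H = 1"
proof -
  interpret H: wf_digraph "with_proj H" by fact
  let ?G = "mk_symmetric (with_proj H)"
  interpret G: pair_wf_digraph ?G by (rule H.wellformed_mk_symmetric)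
  have "strongly_connected (with_proj ?G)" using assms(2) by (simp add: connected_def)
  then have ne: "pverts ?G \<noteq> {}"
    and reach: "\<And>u v. u \<in> pverts ?G \<Longrightarrow> v \<in> pverts ?G \<Longrightarrow> u \<rightarrow>\<^sup>*\<^bsub>with_proj ?G\<^esub> v"
    by (auto simp: strongly_connected_def)
  have "G.sccs_verts = {pverts ?G}"
  proof (intro equalityI subsetI)
    fix S assume "S \<in> G.sccs_verts"
    then have S: "S \<noteq> {}" "\<And>u v. u \<in> S \<Longrightarrow> v \<in> S \<Longrightarrow> u \<rightarrow>\<^sup>*\<^bsub>with_proj ?G\<^esub> v"
      and maximal: "\<And>u v. u \<in> S \<Longrightarrow> u \<rightarrow>\<^sup>*\<^bsub>with_proj ?G\<^esub> v \<Longrightarrow> v \<rightarrow>\<^sup>*\<^bsub>with_proj ?G\<^esub> u \<Longrightarrow> v \<in> S"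
      unfolding G.in_sccs_verts_conv_reachable by blast+
    have "S \<subseteq> pverts ?G"
      using S(2) G.reachable_in_verts(1) by blast
    moreover from this have "pverts ?G \<subseteq> S"
      using S(1) maximal reach by blast
    ultimately show "S \<in> {pverts ?G}" by blast
  next
    fix S assume "S \<in> {pverts ?G}"
    with ne reach show "S \<in> G.sccs_verts"
      using G.reachable_in_verts(2) unfolding G.in_sccs_verts_conv_reachable by blast
  qed
  then have "card G.sccs = 1"
    using G.card_sccs_verts by simp
  then show ?thesis by (simp add: num_components_def)
qed

text \<open>Outgoing edges increase the index, so following them from any vertex ends at the sink
  \<open>n + 1\<close>; the symmetrization allows walking back from there.\<close>

lemma connected_if_out_arcs:
  assumes H: "wf_digraph (with_proj H)" "pverts H = {1..n + 1}"
    and E: "parcs H \<subseteq> parcs (K n)" and out: "{1..n} \<subseteq> Domain (parcs H)"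
  shows "connected (with_proj H)"
proof -
  interpret H: wf_digraph "with_proj H" by fact
  let ?G = "mk_symmetric (with_proj H)"
  interpret G: pair_wf_digraph ?G by (rule H.wellformed_mk_symmetric)
  have to_top: "u \<rightarrow>\<^sup>*\<^bsub>with_proj H\<^esub> (n + 1)" if "u \<in> {1..n + 1}" for u
    using that
  proof (induction "n + 1 - u" arbitrary: u rule: less_induct)
    case (less u)
    show ?case
    proof (cases "u = n + 1")
      case True
      then show ?thesis using H(2) by (auto intro: H.reachable_refl)
    next
      case False
      then obtain v where "(u, v) \<in> parcs H" using out less.prems by force
      moreover from this have "v \<in> {1..n + 1}" "u < v" using E by (auto simp: parcs_K)
      ultimately show ?thesis
        using less.hyps[of v] less.prems H.adj_reachable_trans[of u v "n + 1"] by auto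
    qed
  qed
  have "u \<rightarrow>\<^sup>*\<^bsub>with_proj ?G\<^esub> v" if "u \<in> {1..n + 1}" "v \<in> {1..n + 1}" for u v
  proof -
    have "u \<rightarrow>\<^sup>*\<^bsub>with_proj ?G\<^esub> (n + 1)" "v \<rightarrow>\<^sup>*\<^bsub>with_proj ?G\<^esub> (n + 1)"
      using to_top that H.reachable_mk_symmetricI by blast+
    moreover have "(n + 1) \<rightarrow>\<^sup>*\<^bsub>with_proj ?G\<^esub> v"
      using calculation(2) by (rule symmetric_reachable[OF symmetric_mk_symmetric])
    ultimately show ?thesis by (blast intro: G.reachable_trans)
  qed
  then show ?thesis
    using H(2) by (auto simp: connected_def strongly_connected_def)
qed

text \<open>Primitivity gives every vertex an edge, so conservation yields the degree conditions.
  Conversely, equal splitting supplies the flow and the outgoing edges supply connectedness.\<close>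

lemma valid_primitive_iff:
  assumes "1 \<le> n"
  shows "valid_subgraph n a H \<and> primitive n H \<longleftrightarrow>
    pverts H = {1..n + 1} \<and> parcs H \<subseteq> parcs (K n) \<and> {1..n} \<subseteq> Domain (parcs H) \<and>
    {i \<in> {1..n}. a i = 0} \<subseteq> Range (parcs H)" (is "?L \<longleftrightarrow> ?R")
proof
  assume L: ?L
  then have *: "pverts H = {1..n + 1}" "parcs H \<subseteq> parcs (K n)" "Field (parcs H) = {1..n + 1}"
    by (auto simp: valid_subgraph_def primitive_def subgraph_def)
  obtain f where f: "f \<in> Flow n a" "parcs H = {e \<in> parcs (K n). f e > 0}"
    using L by (auto simp: valid_subgraph_def)
  have "{1..n} \<subseteq> Domain (parcs H)"
    using flow_support_degrees(1)[OF f] *(3) by auto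
  moreover have "{i \<in> {1..n}. a i = 0} \<subseteq> Range (parcs H)"
  proof
    fix i assume "i \<in> {i \<in> {1..n}. a i = 0}"
    with calculation show "i \<in> Range (parcs H)"
      by (intro flow_support_degrees(2)[OF f]) auto
  qed
  ultimately show ?R using * by blast
next
  assume R: ?R
  have wf: "wf_digraph (with_proj H)" "wf_digraph (with_proj (K n))"
    using R by (auto simp: wf_digraph_def K_def)
  have field: "Field (parcs H) = {1..n + 1}"
  proof
    show "Field (parcs H) \<subseteq> {1..n + 1}" using R by (auto simp: Field_def parcs_K)
    \<comment> \<open>The sink is covered because the only possible outgoing edge of
      \<open>n\<close> leads to it.\<close>
    from assms R obtain j where "(n, j) \<in> parcs H" by force
    moreover from this have "j = n + 1" using R by (auto simp: parcs_K)
    ultimately have "n + 1 \<in> Range (parcs H)" by auto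
    moreover have "{1..n + 1} = insert (n + 1) {1..n}" by auto
    ultimately show "{1..n + 1} \<subseteq> Field (parcs H)" using R by (auto simp: Field_def)
  qed
  have "subgraph (with_proj H) (with_proj (K n))"
    using R wf by (auto simp: subgraph_def K_def)
  then show ?L
    using R field exists_flow_with_support[of "parcs H" n a] connected_if_out_arcs[OF wf(1)]
    by (auto simp: valid_subgraph_def primitive_def)
qed

text \<open>The edge set determines the subgraph, and with one component and \<open>n + 1\<close>
  vertices the Betti number is \<open>card E - n\<close>.\<close>

lemma primitive_f_poly_eq:
  assumes "1 \<le> n"
  shows "primitive_f_poly n a =
    (\<Sum>E | E \<subseteq> parcs (K n) \<and> {1..n} \<subseteq> Domain E \<and> {i \<in> {1..n}. a i = 0} \<subseteq> Range E.
       monom 1 (card E - n))"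
  unfolding primitive_f_poly_def valid_primitive_iff[OF assms]
proof (rule sum.reindex_bij_witness[of _ "\<lambda>E. \<lparr>pverts = {1..n + 1}, parcs = E\<rparr>" parcs])
  fix H :: "nat pair_pre_digraph"
  assume H: "H \<in> {H. pverts H = {1..n + 1} \<and> parcs H \<subseteq> parcs (K n) \<and>
    {1..n} \<subseteq> Domain (parcs H) \<and> {i \<in> {1..n}. a i = 0} \<subseteq> Range (parcs H)}"
  then have "wf_digraph (with_proj H)" by (auto simp: wf_digraph_def K_def)
  with H have "num_components H = 1"
    by (intro num_components_connected connected_if_out_arcs) auto
  with H show "monom 1 (card (parcs H) - n) = monom (1 :: int) (betti1 H)"
    by (simp add: betti1_def)
qed auto

section \<open>The primitive $f$-polynomial\<close>

text \<open>The factor \<open>x ^ n\<close> turns the weight into \<open>x ^ card E\<close>, which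
  is multiplicative over the tails.\<close>

lemma primitive_f_poly_inclusion_exclusion:
  fixes x :: "int poly fract"
  assumes n: "1 \<le> n" and x: "x = to_fract [:0, 1:]"
  shows "x ^ n * to_fract (primitive_f_poly n a) =
    (\<Sum>T\<in>Pow {i \<in> {1..n}. a i = 0}. (-1) ^ card T *
      (\<Prod>i\<in>{1..n}. (1 + x) ^ card ({i<..n + 1} - T) - 1))"
proof -
  let ?Z = "{i \<in> {1..n}. a i = 0}"
  let ?F = "{E. E \<subseteq> parcs (K n) \<and> {1..n} \<subseteq> Domain E}"
  have fin_K: "finite (parcs (K n))" by (simp add: parcs_K)
  then have fin: "finite ?F" by simp
  have to_fract_power: "to_fract (p ^ k) = to_fract p ^ k" for p :: "int poly" and k
    by (induction k) simp_all
  have "x ^ n * to_fract (primitive_f_poly n a) =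
      (\<Sum>E | E \<in> ?F \<and> ?Z \<subseteq> Range E. x ^ n * to_fract (monom 1 (card E - n)))"
    by (simp add: primitive_f_poly_eq[OF n] sum_distrib_left conj_assoc)
  also have "\<dots> = (\<Sum>E | E \<in> ?F \<and> ?Z \<subseteq> Range E. x ^ card E)"
  proof (rule sum.cong[OF refl])
    fix E assume "E \<in> {E. E \<in> ?F \<and> ?Z \<subseteq> Range E}"
    then have E: "E \<subseteq> parcs (K n)" "{1..n} \<subseteq> Domain E" by auto
    have "finite E" using E(1) fin_K by (rule finite_subset)
    \<comment> \<open>Each of the \<open>n\<close> tails needs its own edge, so the exponent
      \<open>card E - n\<close> is not truncated.\<close>
    then have "n \<le> card (Domain E)"
      using card_mono[OF finite_Domain E(2)] by simp
    also have "\<dots> \<le> card E"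
      using \<open>finite E\<close> by (simp add: Domain_fst card_image_le)
    finally have "n \<le> card E" .
    then show "x ^ n * to_fract (monom 1 (card E - n)) = x ^ card E"
      by (simp add: x monom_altdef to_fract_power flip: power_add)
  qed
  also have "\<dots> = (\<Sum>T\<in>Pow ?Z. (-1) ^ card T * (\<Sum>E | E \<in> ?F \<and> T \<inter> Range E = {}. x ^ card E))"
    using fin by (rule inclusion_exclusion_sum) simp
  also have "\<dots> = (\<Sum>T\<in>Pow ?Z. (-1) ^ card T * (\<Prod>i\<in>{1..n}. (1 + x) ^ card ({i<..n + 1} - T) - 1))"
  proof (intro sum.cong refl arg_cong2[where f = "(*)"])
    fix T
    \<comment> \<open>Forbidding the heads in \<open>T\<close> only shrinks the successor sets, so
      the choices at different tails stay independent.\<close>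
    have "{E. E \<in> ?F \<and> T \<inter> Range E = {}} =
        {E. E \<subseteq> (SIGMA i:{1..n}. {i<..n + 1} - T) \<and> {1..n} \<subseteq> Domain E}"
      unfolding parcs_K by blast
    then show "(\<Sum>E | E \<in> ?F \<and> T \<inter> Range E = {}. x ^ card E) =
        (\<Prod>i\<in>{1..n}. (1 + x) ^ card ({i<..n + 1} - T) - 1)"
      by (simp only: sum_relations_power_card finite_atLeastAtMost finite_Diff finite_greaterThanAtMost)
  qed
  finally show ?thesis .
qed

text \<open>Position \<open>i\<close> of \<open>a\<close> corresponds to the cut \<open>n + 1 - i\<close>, so the set \<open>T\<close> of vertices forbidden as heads
  is the complement of a set \<open>S\<close> of cuts.\<close>

lemma P_revcomp:
  fixes y :: "nat \<Rightarrow> 'a::comm_ring_1"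
  assumes n: "1 \<le> n" and a: "a 1 \<noteq> 0"
  shows "P n (revcomp n a) y =
    (\<Sum>T\<in>Pow {i \<in> {1..n}. a i = 0}. (-1) ^ card T * (\<Prod>i\<in>{1..n}. y (card ({i<..n + 1} - T))))"
proof -
  let ?Z = "{i \<in> {1..n}. a i = 0}"
  let ?R = "{n - j | j. j \<in> {1..n - 1} \<and> a (j + 1) \<noteq> 0}"
  let ?\<phi> = "\<lambda>S. {i \<in> {2..n}. n + 1 - i \<notin> S}"
  let ?\<psi> = "\<lambda>T. {s \<in> {1..<n}. n + 1 - s \<notin> T}"
  have R: "?R = ?\<psi> ?Z"
  proof (intro equalityI subsetI)
    fix s assume s: "s \<in> ?\<psi> ?Z"
    then have "s = n - (n - s)" "n - s \<in> {1..n - 1}" "a (n - s + 1) \<noteq> 0"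
      by (auto simp: Suc_diff_le)
    then show "s \<in> ?R" by blast
  qed auto
  \<comment> \<open>The supply at vertex 1 keeps it out of \<open>?Z\<close>; the reflection then
    maps \<open>{2..n}\<close> onto the proper cuts \<open>{1..<n}\<close>.\<close>
  have Z: "?Z \<subseteq> {2..n}"
  proof
    fix i assume "i \<in> ?Z"
    with a have "i \<noteq> 1" "1 \<le> i" "i \<le> n" by auto
    then show "i \<in> {2..n}" by simp
  qed
  have "P n (revcomp n a) y = (\<Sum>S | ?R \<subseteq> S \<and> S \<subseteq> {1..<n}.
      (-1) ^ (n - 1 - card S) * (\<Prod>p<n. y (Suc (card {s \<in> S. s \<le> p}))))"
    unfolding revcomp_def by (rule P_comp_of_set[OF n]) auto
  also have "\<dots> = (\<Sum>T\<in>Pow ?Z. (-1) ^ card T * (\<Prod>i\<in>{1..n}. y (card ({i<..n + 1} - T))))"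
  proof (rule sum.reindex_bij_witness[of _ ?\<psi> ?\<phi>])
    fix T assume T: "T \<in> Pow ?Z"
    show "?\<psi> T \<in> {S. ?R \<subseteq> S \<and> S \<subseteq> {1..<n}}"
      using T unfolding R by blast
    show "?\<phi> (?\<psi> T) = T"
    proof (intro equalityI subsetI)
      fix i assume "i \<in> T"
      then have "i \<in> {2..n}" using T Z by blast
      with \<open>i \<in> T\<close> show "i \<in> ?\<phi> (?\<psi> T)" by simp
    qed auto
  next
    fix S assume S: "S \<in> {S. ?R \<subseteq> S \<and> S \<subseteq> {1..<n}}"
    then have sub: "S \<subseteq> {1..<n}" and sup: "?\<psi> ?Z \<subseteq> S" using R by auto
    have fin: "finite S" using sub by (rule finite_subset) simp
    show "?\<psi> (?\<phi> S) = S"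
    proof (intro equalityI subsetI)
      fix s assume "s \<in> S"
      then have "s \<in> {1..<n}" using sub by blast
      with \<open>s \<in> S\<close> show "s \<in> ?\<psi> (?\<phi> S)" by simp
    qed auto
    show "?\<phi> S \<in> Pow ?Z"
    proof (intro PowI subsetI)
      fix i assume i: "i \<in> ?\<phi> S"
      then have "n + 1 - i \<in> {1..<n}" "n + 1 - (n + 1 - i) = i" by auto
      with i sup show "i \<in> ?Z" by auto
    qed
    have "?\<phi> S = (\<lambda>s. n + 1 - s) ` ({1..<n} - S)"
    proof (intro equalityI subsetI)
      fix i assume i: "i \<in> ?\<phi> S"
      then have "i = n + 1 - (n + 1 - i)" "n + 1 - i \<in> {1..<n} - S" by auto
      then show "i \<in> (\<lambda>s. n + 1 - s) ` ({1..<n} - S)" by blast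
    qed auto
    moreover have "inj_on (\<lambda>s. n + 1 - s) ({1..<n} - S)" by (rule inj_onI) auto
    ultimately have card: "card (?\<phi> S) = n - 1 - card S"
      using sub fin by (simp add: card_image card_Diff_subset)
    \<comment> \<open>Reflection sends the allowed heads above \<open>i\<close> other than the sink
      to the cuts at or below \<open>n - i\<close>; the sink accounts for the
      \<open>Suc\<close>.\<close>
    have block: "card ({i<..n + 1} - ?\<phi> S) = Suc (card {s \<in> S. s \<le> n - i})" if i: "i \<in> {1..n}" for i
    proof -
      have "{i<..n + 1} - ?\<phi> S = insert (n + 1) ((\<lambda>s. n + 1 - s) ` {s \<in> S. s \<le> n - i})"
      proof (intro equalityI subsetI)
        fix j assume j: "j \<in> {i<..n + 1} - ?\<phi> S"
        show "j \<in> insert (n + 1) ((\<lambda>s. n + 1 - s) ` {s \<in> S. s \<le> n - i})"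
        proof (cases "j = n + 1")
          case False
          then have "j = n + 1 - (n + 1 - j)" "n + 1 - j \<in> {s \<in> S. s \<le> n - i}"
            using i j by auto
          then show ?thesis by blast
        qed simp
      next
        fix j assume "j \<in> insert (n + 1) ((\<lambda>s. n + 1 - s) ` {s \<in> S. s \<le> n - i})"
        then consider "j = n + 1" | s where "s \<in> S" "s \<le> n - i" "j = n + 1 - s" by blast
        then show "j \<in> {i<..n + 1} - ?\<phi> S"
        proof cases
          case 1
          then show ?thesis using i by simp
        next
          case 2
          then have "s \<in> {1..<n}" using sub by blast
          with 2 i show ?thesis by auto
        qed
      qed
      moreover have "n + 1 \<notin> (\<lambda>s. n + 1 - s) ` {s \<in> S. s \<le> n - i}"
      proof
        assume "n + 1 \<in> (\<lambda>s. n + 1 - s) ` {s \<in> S. s \<le> n - i}"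
        then obtain s where "s \<in> S" "n + 1 = n + 1 - s" by blast
        moreover from this have "1 \<le> s" "s < n" using sub by auto
        ultimately show False by linarith
      qed
      moreover have "inj_on (\<lambda>s. n + 1 - s) {s \<in> S. s \<le> n - i}"
        using sub by (intro inj_onI) auto
      ultimately show ?thesis using fin by (simp add: card_image)
    qed
    have "(\<Prod>i\<in>{1..n}. y (card ({i<..n + 1} - ?\<phi> S))) = (\<Prod>i\<in>{1..n}. y (Suc (card {s \<in> S. s \<le> n - i})))"
      using block by (intro prod.cong refl) simp
    also have "\<dots> = (\<Prod>p<n. y (Suc (card {s \<in> S. s \<le> p})))"
      by (rule prod.reindex_bij_witness[of _ "\<lambda>p. n - p" "\<lambda>i. n - i"]) auto
    finally show "(-1) ^ card (?\<phi> S) * (\<Prod>i\<in>{1..n}. y (card ({i<..n + 1} - ?\<phi> S))) =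
        (-1) ^ (n - 1 - card S) * (\<Prod>p<n. y (Suc (card {s \<in> S. s \<le> p})))"
      by (simp only: card)
  qed
  finally show ?thesis .
qed

theorem lemma3p11:
  fixes n :: nat and a :: "nat \<Rightarrow> nat" and \<alpha> :: "nat list" and x :: "int poly fract"
  assumes "n \<ge> 1" and "a 1 \<noteq> 0"
  defines "\<alpha> \<equiv> revcomp n a" and "x \<equiv> to_fract [:0, 1:]"
  shows "composition n \<alpha> \<and>
    to_fract (primitive_f_poly n a) = 1 / x ^ n * P n \<alpha> (\<lambda>i. (x + 1) ^ i - 1)"
proof
  show "composition n \<alpha>"
    unfolding \<alpha>_def revcomp_def using assms(1) by (intro composition_comp_of_set) auto
  have "x \<noteq> 0" by (simp add: x_def)
  \<comment> \<open>With \<open>y i = (x + 1) ^ i - 1\<close>, both sides are the same alternating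
    sum over the sets \<open>T\<close> of forbidden heads.\<close>
  moreover have "x ^ n * to_fract (primitive_f_poly n a) = P n \<alpha> (\<lambda>i. (x + 1) ^ i - 1)"
    using assms by (simp add: \<alpha>_def P_revcomp primitive_f_poly_inclusion_exclusion add.commute)
  ultimately show "to_fract (primitive_f_poly n a) = 1 / x ^ n * P n \<alpha> (\<lambda>i. (x + 1) ^ i - 1)"
    by (simp add: field_simps)
qed

end
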